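(* Let $(X,\tau)$ be a hereditarily metacompact space. If Player I has a winning strategy in the game $G_1(\mathcal{O},\mathcal{H})$ played on $X$, then $S_1(\mathcal{O},\mathcal{H})$ does not hold for $X$.
   Context: A cover $\mathcal{A}$ of a space is point-finite if for every point $x$ the set $\{A\in\mathcal{A}:x\in A\}$ is finite. A space is metacompact if every open cover has an open refinement (covering the space) that is point-finite; it is hereditarily metacompact if every subspace is metacompact. $\mathcal{O}$ denotes the set of all open covers of $X$, and $\mathcal{H}=\{R\in(\tau\setminus\{\emptyset\})^{\omega}:|\bigcap R|\geq 2\}$. The selection principle $S_1(\mathcal{O},\mathcal{H})$ is the statement: given any sequence $(\mathcal{C}_n)_{n\in\omega}$ of elements of $\mathcal{O}$, for each $n\in\omega$ there is a $C_n\in\mathcal{C}_n$ such that $|\bigcap_{n\in\omega}C_n|\geq 2$. The game $G_1(\mathcal{O},\mathcal{H})$ on $X$: in the $n$-th inning ($n\in\omega$) Player I plays some $\mathcal{C}_n\in\mathcal{O}$ and then Player II chooses some $C_n\in\mathcal{C}_n$. At the end, Player II wins if $|\bigcap_{n\in\omega}C_n|\geq 2$; otherwise Player I wins. *)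

theory Defs
  imports "HOL-Analysis.Analysis"
begin

definition open_covers :: "'a topology \<Rightarrow> 'a set set set" where
  "open_covers X = {\<C>. (\<forall>C\<in>\<C>. openin X C) \<and> \<Union>\<C> = topspace X}"

definition point_finite_on :: "'a set \<Rightarrow> 'a set set \<Rightarrow> bool" where
  "point_finite_on S \<A> \<longleftrightarrow> (\<forall>x\<in>S. finite {A \<in> \<A>. x \<in> A})"

definition metacompact_space :: "'a topology \<Rightarrow> bool" where
  "metacompact_space X \<longleftrightarrow>
     (\<forall>\<U> \<in> open_covers X. \<exists>\<V> \<in> open_covers X.
        (\<forall>V\<in>\<V>. \<exists>U\<in>\<U>. V \<subseteq> U) \<and> point_finite_on (topspace X) \<V>)"

definition hereditarily_metacompact_space :: "'a topology \<Rightarrow> bool" where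
  "hereditarily_metacompact_space X \<longleftrightarrow>
     (\<forall>S. S \<subseteq> topspace X \<longrightarrow> metacompact_space (subtopology X S))"

text \<open>The disjunct for infinite sets is needed because \<open>card\<close> is 0 on them.\<close>

definition at_least_two :: "'a set \<Rightarrow> bool" where
  "at_least_two S \<longleftrightarrow> infinite S \<or> card S \<ge> 2"

definition H_seqs :: "'a topology \<Rightarrow> (nat \<Rightarrow> 'a set) set" where
  "H_seqs X = {R. (\<forall>n. openin X (R n) \<and> R n \<noteq> {}) \<and> at_least_two (\<Inter>n. R n)}"

definition S1 :: "'b set set \<Rightarrow> (nat \<Rightarrow> 'b) set \<Rightarrow> bool" where
  "S1 \<O> \<H> \<longleftrightarrow>
     (\<forall>\<C>. (\<forall>n. \<C> n \<in> \<O>) \<longrightarrow> (\<exists>C. (\<forall>n. C n \<in> \<C> n) \<and> C \<in> \<H>))"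

text \<open>
  A strategy of Player I in the game \<open>G\<^sub>1(\<O>, \<H>)\<close> maps the finite list of Player II's previous
  choices, oldest first, to Player I's next move. Its values matter only on the lists
  that can arise while Player I follows it.
\<close>

definition legal_history :: "('b list \<Rightarrow> 'b set) \<Rightarrow> 'b list \<Rightarrow> bool" where
  "legal_history \<sigma> s \<longleftrightarrow> (\<forall>i < length s. s ! i \<in> \<sigma> (take i s))"

definition G1_strategy_I :: "'b set set \<Rightarrow> ('b list \<Rightarrow> 'b set) \<Rightarrow> bool" where
  "G1_strategy_I \<O> \<sigma> \<longleftrightarrow> (\<forall>s. legal_history \<sigma> s \<longrightarrow> \<sigma> s \<in> \<O>)"

definition G1_winning_strategy_I ::
    "'b set set \<Rightarrow> (nat \<Rightarrow> 'b) set \<Rightarrow> ('b list \<Rightarrow> 'b set) \<Rightarrow> bool" where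
  "G1_winning_strategy_I \<O> \<H> \<sigma> \<longleftrightarrow>
     G1_strategy_I \<O> \<sigma> \<and>
     (\<forall>C. (\<forall>n. C n \<in> \<sigma> (map C [0..<n])) \<longrightarrow> C \<notin> \<H>)"

definition I_wins_G1 :: "'b set set \<Rightarrow> (nat \<Rightarrow> 'b) set \<Rightarrow> bool" where
  "I_wins_G1 \<O> \<H> \<longleftrightarrow> (\<exists>\<sigma>. G1_winning_strategy_I \<O> \<H> \<sigma>)"

text \<open>
  For selections from open covers, membership in \<open>H_seqs X\<close> only says that the intersection
  has at least two points; openness and nonemptiness of the chosen sets are automatic.
\<close>

lemma selection_in_H_seqs_iff:
  assumes "\<And>n. \<C> n \<in> open_covers X" and "\<And>n. C n \<in> \<C> n"
  shows "C \<in> H_seqs X \<longleftrightarrow> at_least_two (\<Inter>n. C n)"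
proof -
  have "openin X (C n)" for n
    using assms unfolding open_covers_def by blast
  moreover have "C n \<noteq> {}" if "at_least_two (\<Inter>n. C n)" for n
  proof
    assume "C n = {}"
    then have "(\<Inter>n. C n) = {}"
      by blast
    with that show False
      by (simp add: at_least_two_def)
  qed
  ultimately show ?thesis
    by (auto simp: H_seqs_def)
qed

end

theory Submission
  imports Defs
begin

text \<open>
  Player I's winning strategy \<open>\<sigma>\<close> spans a tree of positions, and the sequence of covers
  defeating \<open>S\<^sub>1\<close> consists of the levels of this tree, thinned so that each level is point-finite.
  Each position \<open>s\<close> gets an open set \<open>W s\<close>: the root gets the whole space, and hereditary
  metacompactness lets the cover \<open>\<sigma> s\<close>, restricted to \<open>W s\<close>, be shrunk to a point-finite open
  cover of \<open>W s\<close> whose members \<open>W (s @ [U]) \<subseteq> U\<close> are indexed by the answers \<open>U \<in> \<sigma> s\<close>. The sets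
  attached to the positions of length \<open>n\<close> then form an open cover \<open>\<C> n\<close>.

  Suppose that some selection from these covers had two distinct points \<open>x\<close>, \<open>y\<close> in its
  intersection. The positions whose set contains both form a subtree with positions of every
  length, and it is finitely branching because each shrinking is point-finite at \<open>x\<close>. By
  Koenig's lemma it has an infinite branch. The members of the selection need not lie on a
  common branch, but this new branch is a play following \<open>\<sigma>\<close> in which all of Player II's
  choices contain \<open>x\<close> and \<open>y\<close>, so Player I loses it, contrary to the choice of \<open>\<sigma>\<close>.
\<close>

text \<open>
  Finiteness is asked of the indices rather
  than of the sets \<open>f U\<close>, since different answers of Player II lead to different positions even
  if they are shrunk to the same set.
\<close>

definition point_finite_shrinking ::
    "'a topology \<Rightarrow> 'a set \<Rightarrow> 'a set set \<Rightarrow> ('a set \<Rightarrow> 'a set) \<Rightarrow> bool" where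
  "point_finite_shrinking X S \<U> f \<longleftrightarrow>
     (\<forall>U\<in>\<U>. openin X (f U) \<and> f U \<subseteq> U) \<and> (\<Union>U\<in>\<U>. f U) = S \<and>
     (\<forall>x. finite {U \<in> \<U>. x \<in> f U})"

text \<open>
  Assign to each member of a point-finite open refinement one member of \<open>\<U>\<close> above it, and unite
  the members assigned to the same set. A point lies in finitely many members of the
  refinement, hence in the unions belonging to finitely many indices.
\<close>

lemma metacompact_point_finite_shrinking:
  assumes meta: "metacompact_space (subtopology X S)"
    and S: "openin X S" and \<U>: "\<U> \<in> open_covers X"
  shows "\<exists>f. point_finite_shrinking X S \<U> f"
proof -
  have SX: "S \<subseteq> topspace X"
    using S by (rule openin_subset)
  have "(\<lambda>U. U \<inter> S) ` \<U> \<in> open_covers (subtopology X S)"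
    using \<U> SX by (auto simp: open_covers_def openin_subtopology)
  then obtain \<V> where \<V>: "\<V> \<in> open_covers (subtopology X S)"
    and ref: "\<forall>V\<in>\<V>. \<exists>U\<in>(\<lambda>U. U \<inter> S) ` \<U>. V \<subseteq> U"
    and pf: "point_finite_on (topspace (subtopology X S)) \<V>"
    using meta unfolding metacompact_space_def by meson
  have topS: "topspace (subtopology X S) = S"
    using SX by auto
  have "\<exists>U\<in>\<U>. V \<subseteq> U" if "V \<in> \<V>" for V
  proof -
    from bspec[OF ref that] obtain U where "U \<in> \<U>" "V \<subseteq> U \<inter> S"
      by (elim bexE imageE) simp
    then show ?thesis
      by (intro bexI[of _ U]) simp_all
  qed
  then obtain g where g: "\<And>V. V \<in> \<V> \<Longrightarrow> g V \<in> \<U> \<and> V \<subseteq> g V"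
    by metis
  have op: "openin X V" if "V \<in> \<V>" for V
    using \<V> S that by (auto simp: open_covers_def openin_open_subtopology)
  have cov: "\<Union>\<V> = S"
    using \<V> topS by (auto simp: open_covers_def)
  define f where "f U = \<Union>{V \<in> \<V>. g V = U}" for U
  have "finite {U \<in> \<U>. x \<in> f U}" for x
  proof -
    have "finite {V \<in> \<V>. x \<in> V}"
    proof (cases "x \<in> S")
      case True
      then show ?thesis
        using pf topS by (simp add: point_finite_on_def)
    next
      case False
      then have "{V \<in> \<V>. x \<in> V} = {}"
        using cov by blast
      then show ?thesis
        by (simp only: finite.emptyI)
    qed
    moreover have "{U \<in> \<U>. x \<in> f U} \<subseteq> g ` {V \<in> \<V>. x \<in> V}"
      by (auto simp: f_def)
    ultimately show ?thesis
      by (meson finite_surj)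
  qed
  moreover have "openin X (f U) \<and> f U \<subseteq> U" for U
    unfolding f_def using op g by blast
  moreover have "(\<Union>U\<in>\<U>. f U) = S"
    unfolding f_def cov[symmetric] using g by blast
  ultimately show ?thesis
    unfolding point_finite_shrinking_def by blast
qed

lemma legal_history_Nil: "legal_history \<sigma> []"
  by (simp add: legal_history_def)

lemma legal_history_snoc:
  "legal_history \<sigma> (s @ [a]) \<longleftrightarrow> legal_history \<sigma> s \<and> a \<in> \<sigma> s"
  by (auto simp: legal_history_def nth_append less_Suc_eq)

lemma legal_history_map_upt:
  "(\<forall>n. legal_history \<sigma> (map C [0..<n])) \<longleftrightarrow> (\<forall>n. C n \<in> \<sigma> (map C [0..<n]))"
proof (intro iffI allI)
  fix n
  assume "\<forall>n. legal_history \<sigma> (map C [0..<n])"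
  then have "legal_history \<sigma> (map C [0..<Suc n])"
    by blast
  then show "C n \<in> \<sigma> (map C [0..<n])"
    by (simp add: legal_history_snoc)
next
  fix n
  assume "\<forall>n. C n \<in> \<sigma> (map C [0..<n])"
  then show "legal_history \<sigma> (map C [0..<n])"
    by (induction n) (simp_all add: legal_history_Nil legal_history_snoc)
qed

text \<open>
  The branch grows through positions that have extensions in \<open>T\<close> of every length. If no
  one-step extension of such a position \<open>s\<close> had this property, each of its finitely many
  children in \<open>T\<close> would bound the lengths of the extensions through it, and so the lengths of
  all extensions of \<open>s\<close> would be bounded.
\<close>

lemma Konig_lists:
  assumes prefix: "\<And>s t. s @ t \<in> T \<Longrightarrow> s \<in> T"
    and branching: "\<And>s. finite {a. s @ [a] \<in> T}"
    and levels: "\<And>n. \<exists>s\<in>T. length s = n"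
  shows "\<exists>f. \<forall>n. map f [0..<n] \<in> T"
proof -
  define deep where "deep s \<longleftrightarrow> (\<forall>n. \<exists>t. s @ t \<in> T \<and> length t = n)" for s
  have step: "\<exists>a. deep (s @ [a])" if s: "deep s" for s
  proof (rule ccontr)
    assume "\<nexists>a. deep (s @ [a])"
    then have "\<forall>a. \<exists>n. \<forall>t. s @ [a] @ t \<in> T \<longrightarrow> length t \<noteq> n"
      by (simp add: deep_def)
    then obtain h where h: "\<And>a t. s @ [a] @ t \<in> T \<Longrightarrow> length t \<noteq> h a"
      by metis
    define N where "N = (\<Sum>a | s @ [a] \<in> T. h a)"
    obtain t where t: "s @ t \<in> T" "length t = Suc N"
      using s unfolding deep_def by blast
    then obtain a u where u: "t = a # u" "length u = N"
      by (auto simp: length_Suc_conv)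
    have "s @ [a] \<in> T"
      using prefix[of "s @ [a]" u] t u by simp
    then have "h a \<le> N"
      unfolding N_def using branching by (intro member_le_sum) auto
    moreover have "s @ [a] @ take (h a) u \<in> T"
      using prefix[of "s @ [a] @ take (h a) u" "drop (h a) u"] t u by simp
    ultimately show False
      using h[of a "take (h a) u"] u by simp
  qed
  have "deep []"
    using levels by (auto simp: deep_def)
  moreover have "\<exists>s'. (deep s' \<and> length s' = Suc n) \<and> (\<exists>a. s' = s @ [a])"
    if "deep s \<and> length s = n" for s n
    using step[of s] that by auto
  ultimately obtain b where b: "\<And>n. deep (b n) \<and> length (b n) = n"
    and ext: "\<And>n. \<exists>a. b (Suc n) = b n @ [a]"
    using dependent_nat_choice[of "\<lambda>n s. deep s \<and> length s = n" "\<lambda>n s s'. \<exists>a. s' = s @ [a]"]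
    by (metis (no_types, lifting) list.size(3))
  have "map (\<lambda>n. last (b (Suc n))) [0..<n] = b n" for n
  proof (induction n)
    case 0
    then show ?case
      using b[of 0] by simp
  next
    case (Suc n)
    then show ?case
      using ext[of n] by auto
  qed
  moreover have "b n \<in> T" for n
    using b[of n] prefix unfolding deep_def by blast
  ultimately show ?thesis
    by metis
qed

text \<open>
  The recursion runs over positions with the most recent choice first, because a position
  grows at its end.
\<close>

primrec rev_position_set ::
    "('a set \<Rightarrow> 'a set set \<Rightarrow> 'a set \<Rightarrow> 'a set) \<Rightarrow> ('a set list \<Rightarrow> 'a set set) \<Rightarrow> 'a set
      \<Rightarrow> 'a set list \<Rightarrow> 'a set" where
  "rev_position_set f \<sigma> S [] = S"
| "rev_position_set f \<sigma> S (U # r) = f (rev_position_set f \<sigma> S r) (\<sigma> (rev r)) U"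

text \<open>
  All positions are treated at once by choosing a shrinking for every pair of an open set and a
  cover and iterating it along histories. The sets stay open, since the root gets the whole
  space and every other \<open>W s\<close> belongs to the shrinking at the preceding position; hence
  hereditary metacompactness applies again at each step.
\<close>

lemma thinned_strategy_tree:
  assumes X: "hereditarily_metacompact_space X"
    and \<sigma>: "G1_strategy_I (open_covers X) \<sigma>"
  shows "\<exists>W. W [] = topspace X \<and>
    (\<forall>s. legal_history \<sigma> s \<longrightarrow> point_finite_shrinking X (W s) (\<sigma> s) (\<lambda>U. W (s @ [U])))"
proof -
  have "\<exists>f. point_finite_shrinking X S \<U> f" if "openin X S" "\<U> \<in> open_covers X" for S \<U>
    using metacompact_point_finite_shrinking[OF _ that] X openin_subset[OF that(1)]
    unfolding hereditarily_metacompact_space_def by blast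
  then obtain f where f: "\<And>S \<U>. openin X S \<Longrightarrow> \<U> \<in> open_covers X \<Longrightarrow>
      point_finite_shrinking X S \<U> (f S \<U>)"
    by metis
  define W where "W s = rev_position_set f \<sigma> (topspace X) (rev s)" for s
  have W_Nil: "W [] = topspace X" and W_snoc: "W (s @ [U]) = f (W s) (\<sigma> s) U" for s U
    by (simp_all add: W_def)
  have \<sigma>_cover: "\<sigma> s \<in> open_covers X" if "legal_history \<sigma> s" for s
    using \<sigma> that by (simp add: G1_strategy_I_def)
  have "openin X (W s)" if "legal_history \<sigma> s" for s
    using that
  proof (induction s rule: rev_induct)
    case Nil
    then show ?case
      by (simp add: W_Nil)
  next
    case (snoc U s)
    then have "openin X (W s)" "legal_history \<sigma> s" "U \<in> \<sigma> s"
      by (simp_all add: legal_history_snoc)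
    then show ?case
      using f[of "W s" "\<sigma> s"] \<sigma>_cover[of s] by (simp add: W_snoc point_finite_shrinking_def)
  qed
  then show ?thesis
    using f \<sigma>_cover W_Nil by (intro exI[of _ W]) (simp add: W_snoc)
qed

lemma at_least_two_iff: "at_least_two S \<longleftrightarrow> (\<exists>x\<in>S. \<exists>y\<in>S. x \<noteq> y)"
proof
  assume two: "at_least_two S"
  show "\<exists>x\<in>S. \<exists>y\<in>S. x \<noteq> y"
  proof (rule ccontr)
    assume "\<not> (\<exists>x\<in>S. \<exists>y\<in>S. x \<noteq> y)"
    then have "S = {} \<or> (\<exists>x. S = {x})"
      by blast
    then show False
      using two by (auto simp: at_least_two_def)
  qed
next
  assume "\<exists>x\<in>S. \<exists>y\<in>S. x \<noteq> y"
  then obtain x y where xy: "{x, y} \<subseteq> S" "x \<noteq> y"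
    by blast
  then show "at_least_two S"
    using card_mono[of S "{x, y}"] by (auto simp: at_least_two_def)
qed

theorem corollary2p8:
  fixes X :: "'a topology"
  assumes "hereditarily_metacompact_space X"
    and "I_wins_G1 (open_covers X) (H_seqs X)"
  shows "\<not> S1 (open_covers X) (H_seqs X)"
proof
  assume S1: "S1 (open_covers X) (H_seqs X)"
  obtain \<sigma> where \<sigma>: "G1_strategy_I (open_covers X) \<sigma>"
    and win: "\<And>C. (\<And>n. C n \<in> \<sigma> (map C [0..<n])) \<Longrightarrow> C \<notin> H_seqs X"
    using assms(2) unfolding I_wins_G1_def G1_winning_strategy_I_def by blast
  obtain W where W_Nil: "W [] = topspace X"
    and shrink: "\<And>s. legal_history \<sigma> s \<Longrightarrow>
      point_finite_shrinking X (W s) (\<sigma> s) (\<lambda>U. W (s @ [U]))"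
    using thinned_strategy_tree[OF assms(1) \<sigma>] by blast
  have W_subset: "W (s @ [U]) \<subseteq> W s" "W (s @ [U]) \<subseteq> U" and W_open: "openin X (W (s @ [U]))"
    if "legal_history \<sigma> (s @ [U])" for s U
    using that shrink[of s] by (auto simp: legal_history_snoc point_finite_shrinking_def)
  define \<C> where "\<C> n = W ` {s. legal_history \<sigma> s \<and> length s = n}" for n
  have level_cover: "\<C> n \<in> open_covers X" for n
  proof (induction n)
    case 0
    have "\<C> 0 = {topspace X}"
      by (auto simp: \<C>_def W_Nil legal_history_Nil intro!: image_eqI[of _ _ "[]"])
    then show ?case
      by (simp add: open_covers_def)
  next
    case (Suc n)
    have sets_open: "openin X A" if "A \<in> \<C> (Suc n)" for A
      using that W_open by (auto simp: \<C>_def length_Suc_conv_rev)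
    have "\<Union>(\<C> n) \<subseteq> \<Union>(\<C> (Suc n))"
    proof
      fix x
      assume "x \<in> \<Union>(\<C> n)"
      then obtain s where s: "legal_history \<sigma> s" "length s = n" "x \<in> W s"
        by (auto simp: \<C>_def)
      then obtain U where "U \<in> \<sigma> s" "x \<in> W (s @ [U])"
        using shrink[of s] unfolding point_finite_shrinking_def by blast
      then show "x \<in> \<Union>(\<C> (Suc n))"
        using s by (auto simp: \<C>_def legal_history_snoc intro!: exI[of _ "s @ [U]"])
    qed
    moreover have "\<Union>(\<C> (Suc n)) \<subseteq> topspace X"
      using sets_open openin_subset by blast
    ultimately show ?case
      using Suc sets_open by (auto simp: open_covers_def)
  qed
  then obtain D where D: "\<And>n. D n \<in> \<C> n" "D \<in> H_seqs X"
    using S1 unfolding S1_def by metis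
  then obtain x y where xy: "x \<noteq> y" "\<And>n. x \<in> D n" "\<And>n. y \<in> D n"
    by (auto simp: H_seqs_def at_least_two_iff)
  define T where "T = {s. legal_history \<sigma> s \<and> x \<in> W s \<and> y \<in> W s}"
  have "\<exists>f. \<forall>n. map f [0..<n] \<in> T"
  proof (rule Konig_lists)
    show "s \<in> T" if "s @ t \<in> T" for s t
      using that
    proof (induction t rule: rev_induct)
      case (snoc U t)
      then have "s @ t \<in> T"
        using W_subset(1)[of "s @ t" U] legal_history_snoc[of \<sigma> "s @ t" U] by (auto simp: T_def)
      then show ?case
        by (rule snoc.IH)
    qed simp
    show "finite {U. s @ [U] \<in> T}" for s
    proof (cases "legal_history \<sigma> s")
      case True
      then have "finite {U \<in> \<sigma> s. x \<in> W (s @ [U])}"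
        using shrink[of s] by (simp add: point_finite_shrinking_def)
      then show ?thesis
        by (rule rev_finite_subset) (auto simp: T_def legal_history_snoc)
    qed (simp add: T_def legal_history_snoc)
    show "\<exists>s\<in>T. length s = n" for n
      using D(1)[of n] xy(2,3)[of n] by (auto simp: \<C>_def T_def)
  qed
  then obtain C where C: "\<And>n. map C [0..<n] \<in> T"
    by blast
  then have play: "C n \<in> \<sigma> (map C [0..<n])" for n
    using legal_history_map_upt[of \<sigma> C] by (simp add: T_def)
  have "{x, y} \<subseteq> C n" for n
    using C[of "Suc n"] W_subset(2)[of "map C [0..<n]" "C n"] by (auto simp: T_def)
  then have "at_least_two (\<Inter>n. C n)"
    using xy(1) unfolding at_least_two_iff by blast
  moreover have "\<sigma> (map C [0..<n]) \<in> open_covers X" for n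
    using \<sigma> C[of n] by (simp add: T_def G1_strategy_I_def)
  ultimately have "C \<in> H_seqs X"
    using selection_in_H_seqs_iff[where \<C> = "\<lambda>n. \<sigma> (map C [0..<n])"] play by blast
  with win[OF play] show False
    by blast
qed

end
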